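(* Let $k\ge 0$ be an integer, let $\gamma:I\to\mathbb{R}^3$ be a smooth regular curve with $\|\gamma(t)\|=1$ for all $t\in I$, and let $\theta_0\in\mathbb{R}$ be such that $S_\gamma(t,\theta_0)\neq 0$ for all $t\in I$. Then $\gamma$ is a spherical $k$-slant curve if and only if $I(\gamma)=I(\gamma)(\cdot,\theta_0)$ is a spherical $(k+1)$-slant curve.
   Context: $I\subseteq\mathbb{R}$ is an open interval containing $0$. A curve is spherical if it lies on the unit sphere $S^2\subset\mathbb{R}^3$ centred at the origin. For a regular curve $\gamma:I\to S^2$ and $\theta_0\in\mathbb{R}$ put $$S_\gamma(t,\theta_0)=\|\gamma'(t)\|\cos\left(\int_0^t\frac{\det(\gamma(u),\gamma'(u),\gamma''(u))}{\|\gamma'(u)\|^2}du+\theta_0\right),$$ and let $I(\gamma)(t,\theta_0)=\int S_\gamma(t,\theta_0)\gamma(t)\,dt$ denote an antiderivative of $t\mapsto S_\gamma(t,\theta_0)\gamma(t)$, with the constant of integration chosen so that it takes values in $S^2$ (such a choice exists). $k$-slant curves: for a regular curve $\alpha$ put $\psi_1=\alpha'/\|\alpha'\|$ and $\psi_{j+1}=\psi_j'/\|\psi_j'\|$ for $j\ge1$ (as long as $\psi_j'$ never vanishes). The curve $\alpha$ is $k$-slant if $\psi_1,\dots,\psi_{k+1}$ are defined and $\psi_{k+1}$ makes a constant angle with some fixed nonzero vector. ($0$-slant curves are general helices, $1$-slant curves are slant helices.) *)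

theory Defs
  imports "HOL-Analysis.Analysis"
begin

text \<open>
  Curves are total functions on the reals that are only looked at on an open interval
  \<open>I\<close>; as \<open>I\<close> is open, derivatives at points of \<open>I\<close> do not
  depend on the values outside \<open>I\<close>.
\<close>

type_synonym curve = "real \<Rightarrow> real^3"

definition vderiv :: "curve \<Rightarrow> curve" where
  "vderiv f t = vector_derivative f (at t)"

definition smooth_curve_on :: "real set \<Rightarrow> curve \<Rightarrow> bool" where
  "smooth_curve_on I \<alpha> \<longleftrightarrow> (\<forall>n. \<forall>t\<in>I. (vderiv ^^ n) \<alpha> differentiable (at t))"

definition regular_curve_on :: "real set \<Rightarrow> curve \<Rightarrow> bool" where
  "regular_curve_on I \<alpha> \<longleftrightarrow> smooth_curve_on I \<alpha> \<and> (\<forall>t\<in>I. vderiv \<alpha> t \<noteq> 0)"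

definition spherical_on :: "real set \<Rightarrow> curve \<Rightarrow> bool" where
  "spherical_on I \<alpha> \<longleftrightarrow> (\<forall>t\<in>I. norm (\<alpha> t) = 1)"

text \<open>
  \<open>slant_psi \<alpha> j\<close> is $\psi_j$ for \<open>j \<ge> 1\<close>; the start value
  $\psi_0 = \alpha$ makes $\psi_1 = \alpha'/\|\alpha'\|$ an instance of the recursion.
\<close>

primrec slant_psi :: "curve \<Rightarrow> nat \<Rightarrow> curve" where
  "slant_psi \<alpha> 0 = \<alpha>"
| "slant_psi \<alpha> (Suc j) =
     (\<lambda>t. vderiv (slant_psi \<alpha> j) t /\<^sub>R norm (vderiv (slant_psi \<alpha> j) t))"

definition angle_between :: "real^3 \<Rightarrow> real^3 \<Rightarrow> real" where
  "angle_between x y = arccos ((x \<bullet> y) / (norm x * norm y))"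

text \<open>
  The second conjunct says that $\psi_1, \dots, \psi_{k+1}$ are defined on \<open>I\<close>
  (for \<open>j = 0\<close> it repeats the regularity of \<open>\<alpha>\<close>).
\<close>

definition slant_curve_on :: "nat \<Rightarrow> real set \<Rightarrow> curve \<Rightarrow> bool" where
  "slant_curve_on k I \<alpha> \<longleftrightarrow>
     regular_curve_on I \<alpha> \<and>
     (\<forall>j\<le>k. \<forall>t\<in>I. vderiv (slant_psi \<alpha> j) t \<noteq> 0) \<and>
     (\<exists>d. d \<noteq> 0 \<and> (\<exists>\<phi>. \<forall>t\<in>I. angle_between (slant_psi \<alpha> (Suc k) t) d = \<phi>))"

definition S_fun :: "curve \<Rightarrow> real \<Rightarrow> real \<Rightarrow> real" where
  "S_fun \<gamma> \<theta>\<^sub>0 t =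
     norm (vderiv \<gamma> t) *
     cos ((LBINT u=0..t. det (vector [\<gamma> u, vderiv \<gamma> u, vderiv (vderiv \<gamma>) u] :: real^3^3)
                          / (norm (vderiv \<gamma> u))\<^sup>2) + \<theta>\<^sub>0)"

text \<open>
  The constant of integration need not be unique: if \<open>\<gamma>\<close> lies on a great circle,
  two choices can give a curve on the sphere. So $I(\gamma)(\cdot,\theta_0)$ is rendered as a
  predicate satisfied by every admissible antiderivative.
\<close>

definition spherical_antiderivative_on :: "real set \<Rightarrow> curve \<Rightarrow> real \<Rightarrow> curve \<Rightarrow> bool" where
  "spherical_antiderivative_on I \<gamma> \<theta>\<^sub>0 \<beta> \<longleftrightarrow>
     (\<forall>t\<in>I. (\<beta> has_vector_derivative S_fun \<gamma> \<theta>\<^sub>0 t *\<^sub>R \<gamma> t) (at t)) \<and>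
     spherical_on I \<beta>"

text \<open>An admissible antiderivative exists, so the predicate is never vacuous.\<close>

unbundle cross3_syntax

lemma frame_expansion:
  fixes c g x :: "real^3"
  assumes "c \<bullet> c = 1" "c \<bullet> g = 0"
  shows "(g \<bullet> g) *\<^sub>R x = (x \<bullet> (c \<times> g)) *\<^sub>R (c \<times> g) + (x \<bullet> g) *\<^sub>R g + ((g \<bullet> g) * (x \<bullet> c)) *\<^sub>R c"
proof -
  have hh: "(c \<times> g) \<bullet> (c \<times> g) = (c \<bullet> c) * (g \<bullet> g) - (c \<bullet> g)\<^sup>2"
    by (simp add: cross3_simps power2_eq_square)
  have "((c \<times> g) \<bullet> (c \<times> g)) *\<^sub>R x - (x \<bullet> (c \<times> g)) *\<^sub>R (c \<times> g) = (c \<times> g) \<times> (x \<times> (c \<times> g))"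
    by (simp only: Lagrange[of "c \<times> g" x "c \<times> g"] inner_commute[of x "c \<times> g"])
  also have "x \<times> (c \<times> g) = (x \<bullet> g) *\<^sub>R c - (x \<bullet> c) *\<^sub>R g"
    by (simp add: Lagrange)
  also have "(c \<times> g) \<times> ((x \<bullet> g) *\<^sub>R c - (x \<bullet> c) *\<^sub>R g)
      = (x \<bullet> g) *\<^sub>R ((c \<times> g) \<times> c) - (x \<bullet> c) *\<^sub>R ((c \<times> g) \<times> g)"
    by (simp add: Cross3.right_diff_distrib cross_mult_right)
  also have "(c \<times> g) \<times> c = (c \<bullet> c) *\<^sub>R g - (c \<bullet> g) *\<^sub>R c"
    using cross_skew[of "c \<times> g" c] by (simp add: Lagrange)
  also have "(c \<times> g) \<times> g = (c \<bullet> g) *\<^sub>R g - (g \<bullet> g) *\<^sub>R c"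
    using cross_skew[of "c \<times> g" g] by (simp add: Lagrange inner_commute)
  finally show ?thesis using hh assms by (simp add: algebra_simps)
qed

lemma spherical_antiderivative_exists:
  assumes I: "open I" "is_interval I" "0 \<in> I"
    and reg: "regular_curve_on I \<gamma>" and sph: "spherical_on I \<gamma>"
  shows "\<exists>\<beta>. spherical_antiderivative_on I \<gamma> \<theta>\<^sub>0 \<beta>"
proof -
  define g where "g = vderiv \<gamma>"
  define a where "a = vderiv g"
  define h where "h = (\<lambda>t. \<gamma> t \<times> g t)"
  define p where "p = (\<lambda>u. det (vector [\<gamma> u, g u, a u] :: real^3^3) / (norm (g u))\<^sup>2)"
  define ph where "ph = (\<lambda>t::real. (LBINT u=0..t. p u) + \<theta>\<^sub>0)"
  have sm: "(vderiv ^^ n) \<gamma> differentiable (at t)" if "t \<in> I" for n t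
    using reg that by (auto simp: regular_curve_on_def smooth_curve_on_def)
  have g0: "g t \<noteq> 0" if "t \<in> I" for t
    using reg that by (auto simp: regular_curve_on_def g_def)
  have dc: "(\<gamma> has_vector_derivative g t) (at t)" if "t \<in> I" for t
    using sm[OF that, of 0] by (simp add: g_def vderiv_def vector_derivative_works)
  have dg: "(g has_vector_derivative a t) (at t)" if "t \<in> I" for t
    using sm[OF that, of 1] by (simp add: g_def a_def vderiv_def[of "vderiv \<gamma>"] vector_derivative_works)
  have da: "a differentiable (at t)" if "t \<in> I" for t
    using sm[OF that, of 2] by (simp add: g_def a_def numeral_2_eq_2)
  have cc: "\<gamma> t \<bullet> \<gamma> t = 1" if "t \<in> I" for t
    using sph that by (simp add: spherical_on_def norm_eq_1)
  have locconst: "y = 0" if "(f has_vector_derivative y) (at t)" "t \<in> I" "\<And>s. s \<in> I \<Longrightarrow> f s = c"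
    for f :: "real \<Rightarrow> real" and y t c
  proof -
    have "((\<lambda>_. c) has_vector_derivative y) (at t)"
      using has_vector_derivative_transform_within_open[OF that(1) I(1) that(2)] that(3) by auto
    then show "y = 0"
      using vector_derivative_unique_at has_vector_derivative_const by blast
  qed
  have cg: "\<gamma> t \<bullet> g t = 0" if t: "t \<in> I" for t
  proof -
    have "((\<lambda>s. \<gamma> s \<bullet> \<gamma> s) has_vector_derivative (\<gamma> t \<bullet> g t + g t \<bullet> \<gamma> t)) (at t)"
      using bounded_bilinear.has_vector_derivative[OF bounded_bilinear_inner dc[OF t] dc[OF t]] .
    from locconst[OF this t cc] show ?thesis by (simp add: inner_commute)
  qed
  have ca: "\<gamma> t \<bullet> a t = - (g t \<bullet> g t)" if t: "t \<in> I" for t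
  proof -
    have "((\<lambda>s. \<gamma> s \<bullet> g s) has_vector_derivative (\<gamma> t \<bullet> a t + g t \<bullet> g t)) (at t)"
      using bounded_bilinear.has_vector_derivative[OF bounded_bilinear_inner dc[OF t] dg[OF t]] .
    from locconst[OF this t cg] show ?thesis by simp
  qed
  have bl: "bounded_bilinear cross3"
    using bilinear_cross bilinear_conv_bounded_bilinear by blast
  have dh: "(h has_vector_derivative \<gamma> t \<times> a t) (at t)" if t: "t \<in> I" for t
    using bounded_bilinear.has_vector_derivative[OF bl dc[OF t] dg[OF t]] by (simp add: h_def)
  have pdef: "p u = (a u \<bullet> h u) / (g u \<bullet> g u)" for u
    unfolding p_def h_def power2_norm_eq_inner
    by (simp add: dot_cross_det[symmetric]) (simp add: cross3_simps)
  have contp: "continuous_on I p"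
  proof -
    have "continuous_on I a" "continuous_on I g" "continuous_on I h"
      using da dg dh by (meson continuous_at_imp_continuous_on differentiable_imp_continuous_within has_vector_derivative_continuous)+
    then show ?thesis unfolding pdef using g0
      by (intro continuous_intros) auto
  qed
  have dph: "(ph has_real_derivative p t) (at t)" if t: "t \<in> I" for t
  proof -
    obtain e where e: "e > 0" "cball t e \<subseteq> I" using I(1) t open_contains_cball by blast
    define l r where "l = min 0 (t - e)" and "r = max 0 (t + e)"
    have "t - e \<in> I" "t + e \<in> I" using e by (auto simp: dist_real_def subset_iff)
    then have "l \<in> I" "r \<in> I" using I(3) by (auto simp: l_def r_def min_def max_def)
    then have sub: "{l..r} \<subseteq> I" using I(2) by (meson atLeastAtMost_iff mem_is_interval_1_I subsetI)
    have lr: "l \<le> 0" "0 \<le> r" "l < t" "t < r" using e by (auto simp: l_def r_def)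
    have "((\<lambda>u. LBINT y=0..u. p y) has_vector_derivative p t) (at t within {l..r})"
      using interval_integral_FTC2[of l 0 r p t] continuous_on_subset[OF contp sub] lr
      by (simp add: zero_ereal_def)
    then have "((\<lambda>u. LBINT y=0..u. p y) has_vector_derivative p t) (at t)"
      using lr by (simp add: at_within_Icc_at)
    then show ?thesis
      unfolding ph_def has_real_derivative_iff_has_vector_derivative
      by (auto intro!: derivative_eq_intros)
  qed
  define v where "v = (\<lambda>t. sqrt (g t \<bullet> g t))"
  define \<beta> where "\<beta> = (\<lambda>t. (1 / v t) *\<^sub>R (sin (ph t) *\<^sub>R h t - cos (ph t) *\<^sub>R g t))"
  have hh: "h t \<bullet> h t = g t \<bullet> g t" "h t \<bullet> g t = 0" if "t \<in> I" for t
  proof -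
    have "h t \<bullet> h t = (\<gamma> t \<bullet> \<gamma> t) * (g t \<bullet> g t) - (\<gamma> t \<bullet> g t)\<^sup>2"
      by (simp add: h_def cross3_simps power2_eq_square)
    then show "h t \<bullet> h t = g t \<bullet> g t" using cc cg that by simp
    show "h t \<bullet> g t = 0" by (simp add: h_def dot_cross_self)
  qed
  have vv: "v t > 0" "(v t)\<^sup>2 = g t \<bullet> g t" if "t \<in> I" for t
    using g0[OF that] by (auto simp: v_def)
  have S: "S_fun \<gamma> \<theta>\<^sub>0 t = v t * cos (ph t)" for t
    by (simp add: S_fun_def v_def norm_eq_sqrt_inner ph_def p_def g_def a_def)
  have norm: "norm (\<beta> t) = 1" if t: "t \<in> I" for t
  proof -
    have "\<beta> t \<bullet> \<beta> t = (1 / v t)\<^sup>2 * ((sin (ph t))\<^sup>2 * (h t \<bullet> h t) + (cos (ph t))\<^sup>2 * (g t \<bullet> g t)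
        - 2 * sin (ph t) * cos (ph t) * (h t \<bullet> g t))"
      by (simp add: \<beta>_def inner_diff_left inner_diff_right inner_commute power2_eq_square algebra_simps)
    also have "\<dots> = (1 / v t)\<^sup>2 * ((sin (ph t))\<^sup>2 + (cos (ph t))\<^sup>2) * (v t)\<^sup>2"
      unfolding hh[OF t] vv(2)[OF t] by (simp add: distrib_left distrib_right del: sin_cos_squared_add sin_cos_squared_add2)
    also have "\<dots> = 1" using vv(1)[OF t] by (simp add: field_simps)
    finally show ?thesis by (simp add: norm_eq_1)
  qed
  have deriv: "(\<beta> has_vector_derivative S_fun \<gamma> \<theta>\<^sub>0 t *\<^sub>R \<gamma> t) (at t)" if t: "t \<in> I" for t
  proof -
    define q where "q = g t \<bullet> a t"
    have gg: "((\<lambda>s. g s \<bullet> g s) has_real_derivative 2 * q) (at t)"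
      unfolding has_real_derivative_iff_has_vector_derivative q_def
      using bounded_bilinear.has_vector_derivative[OF bounded_bilinear_inner dg[OF t] dg[OF t]]
      by (simp add: inner_commute)
    have "(v has_real_derivative 2 * q * (inverse (v t) / 2)) (at t)"
      unfolding v_def
      by (rule DERIV_chain'[OF gg DERIV_real_sqrt, THEN DERIV_cong]) (use g0[OF t] in auto)
    then have dw: "((\<lambda>s. 1 / v s) has_real_derivative - q / (v t)^3) (at t)"
      using vv(1)[OF t] by (auto intro!: derivative_eq_intros simp: field_simps power3_eq_cube)
    have ds: "((\<lambda>s. sin (ph s)) has_real_derivative cos (ph t) * p t) (at t)"
      and dco: "((\<lambda>s. cos (ph s)) has_real_derivative - (sin (ph t) * p t)) (at t)"
      using dph[OF t] by (auto intro!: derivative_eq_intros)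
    have "(\<beta> has_vector_derivative
        (1 / v t) *\<^sub>R (sin (ph t) *\<^sub>R (\<gamma> t \<times> a t) + (cos (ph t) * p t) *\<^sub>R h t
          - (cos (ph t) *\<^sub>R a t + (- (sin (ph t) * p t)) *\<^sub>R g t))
        + (- q / (v t)^3) *\<^sub>R (sin (ph t) *\<^sub>R h t - cos (ph t) *\<^sub>R g t)) (at t)"
      unfolding \<beta>_def
      by (intro has_vector_derivative_scaleR has_vector_derivative_diff dw ds dco dh[OF t] dg[OF t])
    moreover have aexp: "a t = p t *\<^sub>R h t + (q / (v t)\<^sup>2) *\<^sub>R g t - (v t)\<^sup>2 *\<^sub>R \<gamma> t"
    proof -
      have "(v t)\<^sup>2 *\<^sub>R a t = (a t \<bullet> h t) *\<^sub>R h t + q *\<^sub>R g t - ((v t)\<^sup>2 * (v t)\<^sup>2) *\<^sub>R \<gamma> t"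
        using frame_expansion[OF cc[OF t] cg[OF t], of "a t"] ca[OF t] vv(2)[OF t]
        by (simp add: h_def q_def inner_commute)
      also have "\<dots> = (v t)\<^sup>2 *\<^sub>R (p t *\<^sub>R h t + (q / (v t)\<^sup>2) *\<^sub>R g t - (v t)\<^sup>2 *\<^sub>R \<gamma> t)"
        using vv[OF t] g0[OF t] by (simp add: pdef algebra_simps)
      finally show ?thesis using vv(1)[OF t] by simp
    qed
    moreover have caexp: "\<gamma> t \<times> a t = (q / (v t)\<^sup>2) *\<^sub>R h t - p t *\<^sub>R g t"
    proof -
      have "\<gamma> t \<times> h t = - g t"
        unfolding h_def by (simp add: Lagrange cc[OF t] cg[OF t])
      moreover have "\<gamma> t \<times> g t = h t" by (simp add: h_def)
      ultimately show ?thesis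
        by (subst aexp) (simp add: cross_add_right Cross3.right_diff_distrib cross_mult_right)
    qed
    ultimately have d: "(\<beta> has_vector_derivative
        (1 / v t) *\<^sub>R (sin (ph t) *\<^sub>R ((q / (v t)\<^sup>2) *\<^sub>R h t - p t *\<^sub>R g t) + (cos (ph t) * p t) *\<^sub>R h t
          - (cos (ph t) *\<^sub>R (p t *\<^sub>R h t + (q / (v t)\<^sup>2) *\<^sub>R g t - (v t)\<^sup>2 *\<^sub>R \<gamma> t) + (- (sin (ph t) * p t)) *\<^sub>R g t))
        + (- q / (v t)^3) *\<^sub>R (sin (ph t) *\<^sub>R h t - cos (ph t) *\<^sub>R g t)) (at t)"
      by simp
    show ?thesis
      unfolding S
      by (rule back_subst[where P = "\<lambda>y. (\<beta> has_vector_derivative y) (at t)", OF d])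
        (use vv(1)[OF t] in \<open>simp add: vec_eq_iff field_simps power2_eq_square power3_eq_cube\<close>)
  qed
  show ?thesis
    using norm deriv by (auto simp: spherical_antiderivative_on_def spherical_on_def)
qed

unbundle no cross3_syntax

end

theory Submission
  imports Defs
begin

text \<open>
  The idea is that \<open>\<beta>' = S \<gamma>\<close> with \<open>S\<close> of constant sign \<open>\<sigma>\<close>, so the unit tangent of
  \<open>\<beta>\<close> is \<open>\<sigma> \<gamma>\<close>: the sequence $\psi_1, \psi_2, \dots$ of \<open>\<beta>\<close> is, up to the global sign
  \<open>\<sigma>\<close>, the sequence $\gamma, \psi_1, \psi_2, \dots$ of \<open>\<gamma>\<close>, shifted by one
  (\<open>slant_psi_shift\<close>). The vector \<open>d\<close> serves as an axis for \<open>\<gamma>\<close> exactly when \<open>\<sigma> d\<close> serves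
  as an axis for \<open>\<beta>\<close>, because the angle does not change when both vectors change sign.

  Two points need care. First, \<open>\<beta>\<close> has to be smooth, and \<open>S\<close> contains an integral. This
  integral never has to be differentiated: since \<open>\<beta>\<close> is a unit vector and \<open>S\<close> does not
  vanish, \<open>\<beta> \<bullet> \<gamma> = 0\<close>, and differentiating once more gives \<open>S = - (\<beta> \<bullet> \<gamma>')\<close>. So \<open>\<beta>\<close> solves
  the linear differential equation \<open>\<beta>' = - (\<beta> \<bullet> \<gamma>') \<gamma>\<close> with smooth coefficients and gains
  one derivative at each use of it; the same formula shows that \<open>S\<close> is continuous, hence of
  constant sign. Second, \<open>vderiv\<close> has a meaningful value only at points of differentiability,
  so the comparison of the two sequences has to carry the smoothness of each $\psi_j$ along; this
  rests on the fact that normalising a nowhere vanishing smooth curve keeps it smooth.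
\<close>

section \<open>Finitely often differentiable curves\<close>

text \<open>
  Unlike \<open>smooth_curve_on\<close>, this notion covers scalar functions as well, and it counts the
  derivatives. Both are needed to show by induction on \<open>n\<close> that smoothness survives inner
  products, normalisation and the solution of differential equations.
\<close>

primrec times_differentiable_on ::
    "nat \<Rightarrow> real set \<Rightarrow> (real \<Rightarrow> 'a::real_normed_vector) \<Rightarrow> bool" where
  "times_differentiable_on 0 I f \<longleftrightarrow> True"
| "times_differentiable_on (Suc n) I f \<longleftrightarrow>
     (\<exists>f'. (\<forall>t\<in>I. (f has_vector_derivative f' t) (at t)) \<and> times_differentiable_on n I f')"

lemma times_differentiable_on_SucI:
  assumes "\<And>t. t \<in> I \<Longrightarrow> (f has_vector_derivative f' t) (at t)"
    and "times_differentiable_on n I f'"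
  shows "times_differentiable_on (Suc n) I f"
  using assms by auto

lemma times_differentiable_on_SucD:
  "times_differentiable_on (Suc n) I f \<Longrightarrow> times_differentiable_on n I f"
proof (induction n arbitrary: f)
  case (Suc n)
  then obtain f' where "\<forall>t\<in>I. (f has_vector_derivative f' t) (at t)"
      "times_differentiable_on (Suc n) I f'"
    using times_differentiable_on.simps(2)[of "Suc n"] by blast
  with Suc.IH show ?case by auto
qed simp

lemma times_differentiable_on_cong:
  assumes "open I" "\<And>t. t \<in> I \<Longrightarrow> f t = g t" "times_differentiable_on n I f"
  shows "times_differentiable_on n I g"
proof (cases n)
  case (Suc m)
  then obtain f' where f': "\<forall>t\<in>I. (f has_vector_derivative f' t) (at t)"
      "times_differentiable_on m I f'"
    using assms(3) by auto
  have "(g has_vector_derivative f' t) (at t)" if "t \<in> I" for t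
    using has_vector_derivative_transform_within_open[OF _ assms(1) that] f'(1) that assms(2)
    by blast
  with f'(2) Suc show ?thesis by auto
qed simp

lemma times_differentiable_on_add:
  "times_differentiable_on n I f \<Longrightarrow> times_differentiable_on n I g \<Longrightarrow>
    times_differentiable_on n I (\<lambda>t. f t + g t)"
proof (induction n arbitrary: f g)
  case (Suc n)
  then obtain f' g' where "\<forall>t\<in>I. (f has_vector_derivative f' t) (at t)"
      "\<forall>t\<in>I. (g has_vector_derivative g' t) (at t)"
      "times_differentiable_on n I f'" "times_differentiable_on n I g'"
    by auto
  with Suc.IH[of f' g'] show ?case
    by (intro times_differentiable_on_SucI[where f' = "\<lambda>t. f' t + g' t"]
        has_vector_derivative_add) auto
qed simp

lemma times_differentiable_on_bilinear:
  assumes "bounded_bilinear mul"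
  shows "times_differentiable_on n I f \<Longrightarrow> times_differentiable_on n I g \<Longrightarrow>
    times_differentiable_on n I (\<lambda>t. mul (f t) (g t))"
proof (induction n arbitrary: f g)
  case (Suc n)
  then obtain f' g' where d: "\<forall>t\<in>I. (f has_vector_derivative f' t) (at t)"
      "\<forall>t\<in>I. (g has_vector_derivative g' t) (at t)"
      and n: "times_differentiable_on n I f'" "times_differentiable_on n I g'"
    by auto
  have "times_differentiable_on n I (\<lambda>t. mul (f t) (g' t) + mul (f' t) (g t))"
    using Suc.prems[THEN times_differentiable_on_SucD] n
    by (intro times_differentiable_on_add Suc.IH)
  with d show ?case
    by (intro times_differentiable_on_SucI[where f' = "\<lambda>t. mul (f t) (g' t) + mul (f' t) (g t)"]
        bounded_bilinear.has_vector_derivative[OF assms]) auto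
qed simp

lemmas times_differentiable_on_scaleR =
  times_differentiable_on_bilinear[OF bounded_bilinear_scaleR]
lemmas times_differentiable_on_mult =
  times_differentiable_on_bilinear[OF bounded_bilinear_mult]
lemmas times_differentiable_on_inner =
  times_differentiable_on_bilinear[OF bounded_bilinear_inner]

lemma times_differentiable_on_const: "times_differentiable_on n I (\<lambda>t. c)"
proof (induction n arbitrary: c)
  case (Suc n)
  show ?case
    by (rule times_differentiable_on_SucI[where f' = "\<lambda>t. 0"]) (auto intro: Suc)
qed simp

lemma times_differentiable_on_uminus:
  assumes "times_differentiable_on n I f"
  shows "times_differentiable_on n I (\<lambda>t. - f t)"
  using times_differentiable_on_scaleR[OF times_differentiable_on_const[of n I "- 1"] assms]
  by simp

text \<open>
  The derivative of \<open>w = 1 / \<parallel>f\<parallel>\<close> is \<open>- (f \<bullet> f') w^3\<close>, which is again built from \<open>w\<close>, \<open>f\<close>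
  and \<open>f'\<close> by products alone; this is what makes the induction close.
\<close>

lemma times_differentiable_on_inverse_norm:
  fixes f :: "real \<Rightarrow> 'a::real_inner"
  assumes nz: "\<And>t. t \<in> I \<Longrightarrow> f t \<noteq> 0"
  shows "times_differentiable_on n I f \<Longrightarrow> times_differentiable_on n I (\<lambda>t. inverse (norm (f t)))"
proof (induction n)
  case (Suc n)
  define w where "w = (\<lambda>t. inverse (norm (f t)))"
  obtain f' where d: "\<And>t. t \<in> I \<Longrightarrow> (f has_vector_derivative f' t) (at t)"
      and n: "times_differentiable_on n I f'"
    using Suc.prems by auto
  have "(w has_vector_derivative - ((f t \<bullet> f' t) * (w t * (w t * w t)))) (at t)" if t: "t \<in> I" for t
  proof -
    have gg: "((\<lambda>s. f s \<bullet> f s) has_real_derivative 2 * (f t \<bullet> f' t)) (at t)"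
      unfolding has_real_derivative_iff_has_vector_derivative
      using bounded_bilinear.has_vector_derivative[OF bounded_bilinear_inner d[OF t] d[OF t]]
      by (simp add: inner_commute)
    have "((\<lambda>s. norm (f s)) has_real_derivative 2 * (f t \<bullet> f' t) * (inverse (norm (f t)) / 2)) (at t)"
      unfolding norm_eq_sqrt_inner
      by (rule DERIV_chain'[OF gg DERIV_real_sqrt, THEN DERIV_cong]) (use nz[OF t] in auto)
    then have "(w has_real_derivative - ((f t \<bullet> f' t) * (w t * (w t * w t)))) (at t)"
      unfolding w_def using nz[OF t]
      by (auto intro!: derivative_eq_intros simp: field_simps)
    then show ?thesis by (simp add: has_real_derivative_iff_has_vector_derivative)
  qed
  moreover have "times_differentiable_on n I w" "times_differentiable_on n I f"
    using Suc.IH times_differentiable_on_SucD[OF Suc.prems] by (auto simp: w_def)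
  then have "times_differentiable_on n I (\<lambda>t. - ((f t \<bullet> f' t) * (w t * (w t * w t))))"
    using n by (intro times_differentiable_on_uminus times_differentiable_on_mult
        times_differentiable_on_inner)
  ultimately have "times_differentiable_on (Suc n) I w"
    by (rule times_differentiable_on_SucI)
  then show ?case by (simp only: w_def)
qed simp

section \<open>Smooth curves\<close>

lemma vderiv_eqI: "(f has_vector_derivative y) (at t) \<Longrightarrow> vderiv f t = y"
  by (simp add: vderiv_def vector_derivative_at)

lemma smooth_curve_on_has_vderiv:
  assumes "smooth_curve_on I f" "t \<in> I"
  shows "(f has_vector_derivative vderiv f t) (at t)"
proof -
  have "(vderiv ^^ 0) f differentiable (at t)"
    using assms unfolding smooth_curve_on_def by blast
  then show ?thesis by (simp add: vderiv_def vector_derivative_works)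
qed

lemma smooth_curve_on_vderiv:
  assumes "smooth_curve_on I f"
  shows "smooth_curve_on I (vderiv f)"
  unfolding smooth_curve_on_def
proof (intro allI ballI)
  fix n t assume "t \<in> I"
  then have "(vderiv ^^ Suc n) f differentiable (at t)"
    using assms unfolding smooth_curve_on_def by blast
  then show "(vderiv ^^ n) (vderiv f) differentiable (at t)"
    by (simp add: funpow_swap1)
qed

lemma smooth_curve_on_imp_times_differentiable_on:
  "smooth_curve_on I f \<Longrightarrow> times_differentiable_on n I f"
proof (induction n arbitrary: f)
  case (Suc n)
  then show ?case
    using smooth_curve_on_has_vderiv smooth_curve_on_vderiv
    by (intro times_differentiable_on_SucI[where f' = "vderiv f"]) auto
qed simp

lemma smooth_curve_onI:
  assumes "open I" and "\<And>n. times_differentiable_on n I f"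
  shows "smooth_curve_on I f"
proof -
  have "(vderiv ^^ m) f differentiable (at t)"
    if "t \<in> I" "\<And>n. times_differentiable_on n I f" for m t f
    using that(2)
  proof (induction m arbitrary: f)
    case 0
    from 0[of 1] \<open>t \<in> I\<close> show ?case
      by (auto intro: differentiableI_vector)
  next
    case (Suc m)
    have "times_differentiable_on n I (vderiv f)" for n
    proof -
      obtain f' where f': "\<forall>t\<in>I. (f has_vector_derivative f' t) (at t)"
          "times_differentiable_on n I f'"
        using Suc.prems[of "Suc n"] by auto
      then show ?thesis
        using times_differentiable_on_cong[OF assms(1), of f' "vderiv f"] vderiv_eqI by metis
    qed
    from Suc.IH[OF this] show ?case by (simp add: funpow_swap1)
  qed
  with assms(2) show ?thesis by (simp add: smooth_curve_on_def)
qed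

lemma smooth_curve_on_normalise:
  assumes "open I" "smooth_curve_on I f" "\<And>t. t \<in> I \<Longrightarrow> f t \<noteq> 0"
  shows "smooth_curve_on I (\<lambda>t. f t /\<^sub>R norm (f t))"
  using assms smooth_curve_on_imp_times_differentiable_on
  by (intro smooth_curve_onI times_differentiable_on_scaleR times_differentiable_on_inverse_norm)

lemma vderiv_scaleR_on:
  assumes "open I" "t \<in> I" "smooth_curve_on I f" "\<And>s. s \<in> I \<Longrightarrow> g s = c *\<^sub>R f s"
  shows "vderiv g t = c *\<^sub>R vderiv f t"
proof (rule vderiv_eqI)
  have "((\<lambda>s. c *\<^sub>R f s) has_vector_derivative c *\<^sub>R vderiv f t) (at t)"
    using bounded_linear.has_vector_derivative[OF bounded_linear_scaleR_right
        smooth_curve_on_has_vderiv[OF assms(3,2)]] .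
  then show "(g has_vector_derivative c *\<^sub>R vderiv f t) (at t)"
    using has_vector_derivative_transform_within_open[OF _ assms(1,2)] assms(4) by force
qed

section \<open>Shifting the sequence of iterated unit tangents\<close>

lemma smooth_slant_psi:
  assumes "open I" "smooth_curve_on I \<gamma>"
    and "\<And>i t. i < j \<Longrightarrow> t \<in> I \<Longrightarrow> vderiv (slant_psi \<gamma> i) t \<noteq> 0"
  shows "smooth_curve_on I (slant_psi \<gamma> j)"
  using assms(3)
proof (induction j)
  case 0
  show ?case using assms(2) by simp
next
  case (Suc j)
  then show ?case
    using smooth_curve_on_normalise[OF assms(1) smooth_curve_on_vderiv] by simp
qed

lemma slant_psi_shift:
  assumes I: "open I" and sm: "smooth_curve_on I \<gamma>" and \<sigma>: "\<bar>\<sigma>\<bar> = 1"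
    and first: "\<And>t. t \<in> I \<Longrightarrow> slant_psi \<beta> 1 t = \<sigma> *\<^sub>R \<gamma> t"
    and "\<And>i t. i < j \<Longrightarrow> t \<in> I \<Longrightarrow> vderiv (slant_psi \<gamma> i) t \<noteq> 0"
    and "t \<in> I"
  shows "slant_psi \<beta> (Suc j) t = \<sigma> *\<^sub>R slant_psi \<gamma> j t"
  using assms(5,6)
proof (induction j arbitrary: t)
  case 0
  then show ?case using first by simp
next
  case (Suc j)
  have "smooth_curve_on I (slant_psi \<gamma> j)"
    using smooth_slant_psi[OF I sm] Suc.prems(1) by simp
  then have "vderiv (slant_psi \<beta> (Suc j)) t = \<sigma> *\<^sub>R vderiv (slant_psi \<gamma> j) t"
    using Suc.IH Suc.prems by (intro vderiv_scaleR_on[OF I]) auto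
  then show ?case
    using \<sigma> by (simp only: slant_psi.simps(2) norm_scaleR) simp
qed

text \<open>
  Comparing $\psi_j'$ for the two curves presupposes that $\psi_j$ of \<open>\<gamma>\<close> is smooth, hence that
  all earlier derivatives for \<open>\<gamma>\<close> are nonzero. From right to left this has to be
  established along the way, by strong induction on the index.
\<close>

lemma slant_psi_defined_shift:
  assumes I: "open I" and sm: "smooth_curve_on I \<gamma>" and \<sigma>: "\<bar>\<sigma>\<bar> = 1"
    and first: "\<And>t. t \<in> I \<Longrightarrow> slant_psi \<beta> 1 t = \<sigma> *\<^sub>R \<gamma> t"
  shows "(\<forall>j\<le>k. \<forall>t\<in>I. vderiv (slant_psi \<gamma> j) t \<noteq> 0) \<longleftrightarrow>
         (\<forall>j\<le>k. \<forall>t\<in>I. vderiv (slant_psi \<beta> (Suc j)) t \<noteq> 0)"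
proof -
  have shift: "vderiv (slant_psi \<beta> (Suc j)) t = \<sigma> *\<^sub>R vderiv (slant_psi \<gamma> j) t"
    if "\<forall>i<j. \<forall>t\<in>I. vderiv (slant_psi \<gamma> i) t \<noteq> 0" "t \<in> I" for j t
    using that slant_psi_shift[OF assms] smooth_slant_psi[OF I sm]
    by (intro vderiv_scaleR_on[OF I]) auto
  show ?thesis
  proof
    assume "\<forall>j\<le>k. \<forall>t\<in>I. vderiv (slant_psi \<gamma> j) t \<noteq> 0"
    then show "\<forall>j\<le>k. \<forall>t\<in>I. vderiv (slant_psi \<beta> (Suc j)) t \<noteq> 0"
      using shift \<sigma> by auto
  next
    assume \<beta>: "\<forall>j\<le>k. \<forall>t\<in>I. vderiv (slant_psi \<beta> (Suc j)) t \<noteq> 0"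
    have "j \<le> k \<longrightarrow> (\<forall>t\<in>I. vderiv (slant_psi \<gamma> j) t \<noteq> 0)" for j
    proof (induction j rule: less_induct)
      case (less j)
      show ?case
      proof (intro impI ballI)
        fix t assume "j \<le> k" "t \<in> I"
        with less shift[of j t] have "vderiv (slant_psi \<beta> (Suc j)) t = \<sigma> *\<^sub>R vderiv (slant_psi \<gamma> j) t"
          by auto
        moreover have "vderiv (slant_psi \<beta> (Suc j)) t \<noteq> 0"
          using \<beta> \<open>j \<le> k\<close> \<open>t \<in> I\<close> by blast
        ultimately show "vderiv (slant_psi \<gamma> j) t \<noteq> 0"
          by force
      qed
    qed
    then show "\<forall>j\<le>k. \<forall>t\<in>I. vderiv (slant_psi \<gamma> j) t \<noteq> 0" by blast
  qed
qed

lemma angle_between_scaleR_both: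
  assumes "\<bar>\<sigma>\<bar> = 1"
  shows "angle_between (\<sigma> *\<^sub>R x) (\<sigma> *\<^sub>R d) = angle_between x d"
proof -
  have "\<sigma> * \<sigma> = 1" using assms by (metis abs_mult_self_eq mult_1)
  moreover have "(\<sigma> *\<^sub>R x) \<bullet> (\<sigma> *\<^sub>R d) = (\<sigma> * \<sigma>) * (x \<bullet> d)"
    by simp
  ultimately show ?thesis using assms by (simp only: angle_between_def norm_scaleR mult_1)
qed

lemma constant_angle_scaleR:
  assumes "\<bar>\<sigma>\<bar> = 1" and fg: "\<And>t. t \<in> I \<Longrightarrow> g t = \<sigma> *\<^sub>R f t"
  shows "(\<exists>d. d \<noteq> 0 \<and> (\<exists>\<phi>. \<forall>t\<in>I. angle_between (f t) d = \<phi>)) \<longleftrightarrow>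
         (\<exists>d. d \<noteq> 0 \<and> (\<exists>\<phi>. \<forall>t\<in>I. angle_between (g t) d = \<phi>))"
proof -
  have nz: "\<sigma> \<noteq> 0" using assms(1) by auto
  have ss: "\<sigma> * \<sigma> = 1" using assms(1) by (metis abs_mult_self_eq mult_1)
  have "angle_between (g t) (\<sigma> *\<^sub>R d) = angle_between (f t) d"
    "angle_between (f t) (\<sigma> *\<^sub>R d) = angle_between (g t) d" if "t \<in> I" for t d
    using angle_between_scaleR_both[OF assms(1), of "f t" d]
      angle_between_scaleR_both[OF assms(1), of "f t" "\<sigma> *\<^sub>R d"] fg[OF that] ss by simp_all
  then show ?thesis
    using nz by (metis scaleR_eq_0_iff)
qed

section \<open>The spherical antiderivative\<close>

text \<open>
  Differentiating \<open>\<beta> \<bullet> \<beta> = 1\<close> gives \<open>2 S (\<beta> \<bullet> \<gamma>) = 0\<close>, that is \<open>\<beta> \<bullet> \<gamma> = 0\<close>;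
  differentiating this relation in turn gives \<open>\<beta> \<bullet> \<gamma>' + S (\<gamma> \<bullet> \<gamma>) = 0\<close>.
\<close>

lemma spherical_antiderivative_coefficient:
  fixes \<beta> \<gamma> :: "real \<Rightarrow> 'a::real_inner"
  assumes I: "open I" and t: "t \<in> I"
    and b: "\<And>t. t \<in> I \<Longrightarrow> (\<beta> has_vector_derivative S t *\<^sub>R \<gamma> t) (at t)"
    and g: "\<And>t. t \<in> I \<Longrightarrow> (\<gamma> has_vector_derivative \<gamma>' t) (at t)"
    and nb: "\<And>t. t \<in> I \<Longrightarrow> norm (\<beta> t) = 1" and ng: "\<And>t. t \<in> I \<Longrightarrow> norm (\<gamma> t) = 1"
    and S: "\<And>t. t \<in> I \<Longrightarrow> S t \<noteq> 0"
  shows "S t = - (\<beta> t \<bullet> \<gamma>' t)"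
proof -
  have const: "y = 0" if "(f has_vector_derivative y) (at t)" "t \<in> I" "\<And>s. s \<in> I \<Longrightarrow> f s = c"
    for f :: "real \<Rightarrow> real" and y t c
  proof -
    have "((\<lambda>_. c) has_vector_derivative y) (at t)"
      using has_vector_derivative_transform_within_open[OF that(1) I that(2)] that(3) by auto
    then show "y = 0"
      using vector_derivative_unique_at has_vector_derivative_const by blast
  qed
  have bg: "\<beta> t \<bullet> \<gamma> t = 0" if t: "t \<in> I" for t
  proof -
    have "\<beta> t \<bullet> (S t *\<^sub>R \<gamma> t) + (S t *\<^sub>R \<gamma> t) \<bullet> \<beta> t = 0"
      by (rule const[OF bounded_bilinear.has_vector_derivative[OF bounded_bilinear_inner
              b[OF t] b[OF t]] t]) (use nb in \<open>simp add: norm_eq_1\<close>)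
    then show ?thesis using S[OF t] by (simp add: inner_commute)
  qed
  have "\<beta> t \<bullet> \<gamma>' t + (S t *\<^sub>R \<gamma> t) \<bullet> \<gamma> t = 0"
    by (rule const[OF bounded_bilinear.has_vector_derivative[OF bounded_bilinear_inner
            b[OF t] g[OF t]] t bg])
  moreover have "\<gamma> t \<bullet> \<gamma> t = 1" using ng[OF t] by (simp add: norm_eq_1)
  ultimately show ?thesis by simp
qed

text \<open>
  The right-hand side of the differential equation is as often differentiable as \<open>\<beta>\<close>, so
  each use of the equation raises the differentiability of \<open>\<beta>\<close> by one.
\<close>

lemma smooth_solution:
  assumes "open I" "smooth_curve_on I \<gamma>" "smooth_curve_on I \<delta>"
    and b: "\<And>t. t \<in> I \<Longrightarrow> (\<beta> has_vector_derivative - (\<beta> t \<bullet> \<delta> t) *\<^sub>R \<gamma> t) (at t)"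
  shows "smooth_curve_on I \<beta>"
proof (rule smooth_curve_onI[OF assms(1)])
  fix n
  show "times_differentiable_on n I \<beta>"
  proof (induction n)
    case (Suc n)
    then show ?case
      using assms(2,3)[THEN smooth_curve_on_imp_times_differentiable_on]
      by (intro times_differentiable_on_SucI[OF b] times_differentiable_on_scaleR
          times_differentiable_on_uminus times_differentiable_on_inner)
  qed simp
qed

lemma sgn_constant_on_interval:
  fixes S :: "real \<Rightarrow> real"
  assumes "is_interval I" "continuous_on I S" "\<And>t. t \<in> I \<Longrightarrow> S t \<noteq> 0" "s \<in> I" "t \<in> I"
  shows "sgn (S s) = sgn (S t)"
proof -
  have "is_interval (S ` I)"
    using connected_continuous_image[OF assms(2)] assms(1) by (simp add: is_interval_connected_1)
  moreover have "0 \<notin> S ` I" using assms(3) by force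
  ultimately have "\<not> (S u \<le> 0 \<and> 0 \<le> S v)" if "u \<in> I" "v \<in> I" for u v
    using that mem_is_interval_1_I[of "S ` I" "S u" "S v" 0] by blast
  from this[OF assms(4,5)] this[OF assms(5,4)] show ?thesis
    by (auto simp: sgn_if not_le)
qed

theorem theorem3p1:
  fixes k :: nat and I :: "real set" and \<gamma> \<beta> :: "real \<Rightarrow> real^3" and \<theta>\<^sub>0 :: real
  assumes "open I" and "is_interval I" and "0 \<in> I"
    and "regular_curve_on I \<gamma>" and "\<forall>t\<in>I. norm (\<gamma> t) = 1"
    and "\<forall>t\<in>I. S_fun \<gamma> \<theta>\<^sub>0 t \<noteq> 0"
    and "spherical_antiderivative_on I \<gamma> \<theta>\<^sub>0 \<beta>"
  shows "(spherical_on I \<gamma> \<and> slant_curve_on k I \<gamma>) \<longleftrightarrow>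
         (spherical_on I \<beta> \<and> slant_curve_on (k + 1) I \<beta>)"
proof -
  let ?S = "S_fun \<gamma> \<theta>\<^sub>0"
  define \<sigma> where "\<sigma> = sgn (?S 0)"
  have sm: "smooth_curve_on I \<gamma>" using assms(4) by (simp add: regular_curve_on_def)
  have g: "(\<gamma> has_vector_derivative vderiv \<gamma> t) (at t)" if "t \<in> I" for t
    using smooth_curve_on_has_vderiv[OF sm that] .
  have b: "(\<beta> has_vector_derivative ?S t *\<^sub>R \<gamma> t) (at t)" if "t \<in> I" for t
    using assms(7) that by (simp add: spherical_antiderivative_on_def)
  have sph: "spherical_on I \<gamma>" "spherical_on I \<beta>"
    using assms(5,7) by (auto simp: spherical_antiderivative_on_def spherical_on_def)
  have S: "?S t = - (\<beta> t \<bullet> vderiv \<gamma> t)" if "t \<in> I" for t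
    by (rule spherical_antiderivative_coefficient[OF assms(1) that b g])
      (use sph assms(6) in \<open>auto simp: spherical_on_def\<close>)
  have sm\<beta>: "smooth_curve_on I \<beta>"
    using smooth_solution[OF assms(1) sm smooth_curve_on_vderiv[OF sm]] b S by metis
  have vb: "vderiv \<beta> t = ?S t *\<^sub>R \<gamma> t" if "t \<in> I" for t
    using vderiv_eqI[OF b[OF that]] .
  have vb0: "vderiv \<beta> t \<noteq> 0" if "t \<in> I" for t
    using vb[OF that] assms(5,6) that by force
  have reg\<beta>: "regular_curve_on I \<beta>"
    using sm\<beta> vb0 by (simp add: regular_curve_on_def)
  have "continuous_on I \<beta>" "continuous_on I (vderiv \<gamma>)"
    using smooth_curve_on_has_vderiv[OF sm\<beta>]
      smooth_curve_on_has_vderiv[OF smooth_curve_on_vderiv[OF sm]]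
    by (meson continuous_at_imp_continuous_on has_vector_derivative_continuous)+
  then have "continuous_on I (\<lambda>t. - (\<beta> t \<bullet> vderiv \<gamma> t))"
    by (intro continuous_intros)
  then have "continuous_on I ?S"
    using S by (simp cong: continuous_on_cong)
  then have sgn: "sgn (?S t) = \<sigma>" if "t \<in> I" for t
    unfolding \<sigma>_def using assms(2,3,6) that by (intro sgn_constant_on_interval) auto
  have \<sigma>: "\<bar>\<sigma>\<bar> = 1"
    using assms(3,6) by (auto simp: \<sigma>_def sgn_if)
  have first: "slant_psi \<beta> 1 t = \<sigma> *\<^sub>R \<gamma> t" if "t \<in> I" for t
  proof -
    have "slant_psi \<beta> 1 t = (?S t / \<bar>?S t\<bar>) *\<^sub>R \<gamma> t"
      using vb[OF that] assms(5) that by (simp add: divide_inverse_commute)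
    then show ?thesis using sgn[OF that] by (simp add: real_sgn_eq)
  qed
  note shift = slant_psi_shift[OF assms(1) sm \<sigma> first]
  have "slant_curve_on k I \<gamma> \<longleftrightarrow> slant_curve_on (k + 1) I \<beta>"
  proof (cases "\<forall>j\<le>k. \<forall>t\<in>I. vderiv (slant_psi \<gamma> j) t \<noteq> 0")
    case True
    have \<beta>: "\<forall>j\<le>k + 1. \<forall>t\<in>I. vderiv (slant_psi \<beta> j) t \<noteq> 0"
    proof (intro allI impI ballI)
      fix j t assume "j \<le> k + 1" "t \<in> I"
      then show "vderiv (slant_psi \<beta> j) t \<noteq> 0"
        using slant_psi_defined_shift[OF assms(1) sm \<sigma> first, of k] True vb0
        by (cases j) auto
    qed
    have "slant_psi \<beta> (Suc (k + 1)) t = \<sigma> *\<^sub>R slant_psi \<gamma> (Suc k) t" if "t \<in> I" for t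
      using shift[of "Suc k" t] True that by simp
    from constant_angle_scaleR[OF \<sigma> this] show ?thesis
      using True \<beta> assms(4) reg\<beta> by (simp only: slant_curve_on_def) simp
  next
    case False
    then have "\<not> (\<forall>j\<le>k. \<forall>t\<in>I. vderiv (slant_psi \<beta> (Suc j)) t \<noteq> 0)"
      using slant_psi_defined_shift[OF assms(1) sm \<sigma> first, of k] by blast
    then have "\<not> (\<forall>j\<le>k + 1. \<forall>t\<in>I. vderiv (slant_psi \<beta> j) t \<noteq> 0)"
      by (metis Suc_eq_plus1 Suc_le_mono)
    with False show ?thesis unfolding slant_curve_on_def by blast
  qed
  with sph show ?thesis by blast
qed

end
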